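(* Let $k\ge1$, let $n_1,\dots,n_k\ge2$ be pairwise relatively prime integers, $r\ge1$, $N=n_1\cdots n_k$, and let $p(x)\in\mathbb{Q}[x]$ be a nonzero polynomial of degree $d$. Let $m\ge0$ be an integer sufficiently large that $\lambda>0$, where $$\lambda=m+r(n_1+\cdots+n_k)-(r-1)N-d .$$ Then $$ \sum_{j=1}^kS_t^{(m,r,p(x))}(n_1,\dots,\widehat{n_j},\dots,n_k;n_j)= \begin{cases} \dfrac{1}{N^{r-1}}\bigl(p(0)-\mathrm{poly}'(0)\bigr) & \text{if } t=0,\\[2mm] -\dfrac{1}{N^{r-1}}\,\mathrm{poly}'(-t) & \text{if } 1\le t<\lambda, \end{cases} $$ where $t$ is an integer, the hat means the entry is omitted, and $$ \mathrm{poly}'(t)=\sum_{q=0}^{r-1}\binom{r-1}{q}(-1)^q\,W_1(t-qN). $$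
   Context: Generalized Fourier–Dedekind sum: for a positive integer $b$ coprime to $n_1,\dots,n_k$ and $\xi_b=e^{2\pi i/b}$, $$S_t^{(m,r,p(x))}(n_1,\dots,n_k;b)=\frac{1}{b^r}\sum_{j=1}^{b-1}\frac{p(\xi_b^j)\xi_b^{jt}}{(1-\xi_b^j)^m(1-\xi_b^{jn_1})^r\cdots(1-\xi_b^{jn_k})^r},$$ and for $k=0$ (no entries before the semicolon) $S_t^{(m,r,p(x))}(b)=\frac{1}{b^r}\sum_{j=1}^{b-1}\frac{p(\xi_b^j)\xi_b^{jt}}{(1-\xi_b^j)^m}$. $W_1(t)$ is the polynomial part of the coefficient sequence of $$F(x)=\frac{p(x)}{(1-x)^m(1-x^{n_1})^r\cdots(1-x^{n_k})^r},$$ namely the polynomial in $t$ $$W_1(t)=\sum_{j=0}^{m+rk-1}c_j\binom{t+m+rk-j-1}{m+rk-j-1},$$ with binomials read as polynomials in $t$ (so that $W_1$ may be evaluated at negative arguments), where $$c_j=\frac{1}{(n_1\cdots n_k)^r}\sum_{i_0+\cdots+i_k=j}(-1)^j\frac{p^{(i_0)}(1)}{i_0!}\frac{\tilde\beta_{i_1}^{(r)}(n_1)\cdots\tilde\beta_{i_k}^{(r)}(n_k)}{i_1!\cdots i_k!}.$$ Here $\tilde\beta^{(r)}_k(n)$ are defined by $\left(\frac{n(1-x)}{1-x^n}\right)^r=\sum_{k\ge0}(-1)^k\frac{\tilde\beta_k^{(r)}(n)}{k!}(1-x)^k$. Equivalently, $\sum_{j}c_j(1-x)^{-(m+rk-j)}$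 is the principal part of $F$ at $x=1$. *)

theory Defs
  imports "HOL-Computational_Algebra.Computational_Algebra" "HOL-Analysis.Analysis"
begin

text \<open>
  The generalized Fourier--Dedekind sum. The entries before the semicolon are the family
  \<open>(n i)\<close> for \<open>i \<in> I\<close>, with \<open>I\<close> finite, so omitting an entry is removing its index from \<open>I\<close>;
  \<open>I = {}\<close> is the case without entries.
\<close>

definition fd_sum ::
  "nat \<Rightarrow> nat \<Rightarrow> rat poly \<Rightarrow> int \<Rightarrow> nat set \<Rightarrow> (nat \<Rightarrow> nat) \<Rightarrow> nat \<Rightarrow> complex" where
  "fd_sum m r p t I n b =
     1 / of_nat b ^ r *
     (\<Sum>j = 1..b - 1.
        let x = exp (2 * of_real pi * \<i> / of_nat b) ^ j in
        poly (map_poly of_rat p) x * x powi t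
          / ((1 - x) ^ m * (\<Prod>i\<in>I. (1 - x ^ n i) ^ r)))"

text \<open>
  The series \<open>(n (1 - x) / (1 - x ^ n)) ^ r\<close> in powers of \<open>1 - x\<close>: the variable \<open>fps_X\<close> stands for
  \<open>1 - x\<close>. The division cancels a common factor \<open>fps_X\<close>, hence is exact for \<open>n > 0\<close>.
\<close>

definition beta_gf :: "nat \<Rightarrow> nat \<Rightarrow> rat fps" where
  "beta_gf r n = ((of_nat n * fps_X) / (1 - (1 - fps_X) ^ n)) ^ r"

definition beta :: "nat \<Rightarrow> nat \<Rightarrow> nat \<Rightarrow> rat" where
  "beta r k n = (- 1) ^ k * fact k * fps_nth (beta_gf r n) k"

lemma beta_generating_function:
  "beta_gf r n = Abs_fps (\<lambda>k. (- 1) ^ k * beta r k n / fact k)"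
  by (rule fps_ext) (simp add: beta_def power_mult_distrib [symmetric] flip: mult.assoc)

text \<open>
  \<open>natpermute j (k + 1)\<close> is the set of lists \<open>[i_0, \<dots>, i_k]\<close> of natural numbers with sum \<open>j\<close>.
\<close>

definition pp_coeff :: "nat \<Rightarrow> rat poly \<Rightarrow> nat \<Rightarrow> (nat \<Rightarrow> nat) \<Rightarrow> nat \<Rightarrow> rat" where
  "pp_coeff r p k n j =
     1 / of_nat (\<Prod>l = 1..k. n l) ^ r *
     (\<Sum>i\<in>natpermute j (k + 1).
        (- 1) ^ j * (poly ((pderiv ^^ (i ! 0)) p) 1 / fact (i ! 0))
          * (\<Prod>l = 1..k. beta r (i ! l) (n l) / fact (i ! l)))"

text \<open>
  Generalized binomial coefficients make this a polynomial function of \<open>t\<close>, also for negative \<open>t\<close>.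
\<close>

definition W1 :: "nat \<Rightarrow> nat \<Rightarrow> rat poly \<Rightarrow> nat \<Rightarrow> (nat \<Rightarrow> nat) \<Rightarrow> rat \<Rightarrow> rat" where
  "W1 m r p k n t =
     (\<Sum>j<m + r * k.
        pp_coeff r p k n j * ((t + of_nat (m + r * k - j - 1)) gchoose (m + r * k - j - 1)))"

definition poly' :: "nat \<Rightarrow> nat \<Rightarrow> rat poly \<Rightarrow> nat \<Rightarrow> (nat \<Rightarrow> nat) \<Rightarrow> rat \<Rightarrow> rat" where
  "poly' m r p k n t =
     (\<Sum>q = 0..r - 1.
        of_nat ((r - 1) choose q) * (- 1) ^ q * W1 m r p k n (t - of_nat (q * (\<Prod>l = 1..k. n l))))"

end

theory Submission
  imports Defs "HOL-Computational_Algebra.Field_as_Ring"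
begin

text \<open>
  Let \<open>N = n 1 * \<dots> * n k\<close> and \<open>F x = p x / ((1 - x) ^ m * (\<Prod>i. (1 - x ^ n i) ^ r))\<close>. The identity says
  that the residues of
  \<open>H x = x powi (t - 1) * (1 - x ^ N) ^ (r - 1) * F x\<close> on the Riemann sphere add up to zero.

  The \<open>n i\<close> are pairwise coprime, so a root of unity \<open>w \<noteq> 1\<close> with \<open>w ^ n j = 1\<close> is a pole of \<open>F\<close> of
  order \<open>r\<close> at most, coming from a single \<open>j\<close>. The factor \<open>(1 - x ^ N) ^ (r - 1)\<close> makes it at most a
  simple pole of \<open>H\<close>, and because \<open>(1 - x ^ N) / (1 - x ^ n j)\<close> takes the value \<open>N / n j\<close> at \<open>w\<close>, its
  residue is \<open>- N ^ (r - 1)\<close> times the summand of the Fourier--Dedekind sum with modulus \<open>n j\<close>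
  that belongs to \<open>w\<close>. The point \<open>0\<close> contributes \<open>p 0\<close> for \<open>t = 0\<close> and nothing for \<open>t > 0\<close>. The
  number \<open>lam\<close> is the degree of the denominator of \<open>(1 - x ^ N) ^ (r - 1) * F x\<close> minus that of its
  numerator, so for \<open>t < lam\<close> the form \<open>H x dx\<close> has no residue at infinity. Finally, since the
  numbers \<open>pp_coeff\<close> are the coefficients of the principal part of \<open>F\<close> at \<open>1\<close>, expanding
  \<open>(1 - x ^ N) ^ (r - 1)\<close> binomially shows that the residue at \<open>1\<close> is \<open>- poly' (- t)\<close>.

  The residue theorem enters only for rational functions whose poles, with one exception, are
  simple, and there it has an algebraic proof (\<open>sum_of_residues\<close>). The polynomial
  \<open>(1 - x ^ N) / ((1 - x) * (\<Prod>i. geo (n i)))\<close> supplied by \<open>prod_geo_dvd\<close> brings \<open>H\<close> into that form,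
  \<open>poly'_eq_residue\<close> computes the contribution of the exceptional pole \<open>1\<close>, and
  \<open>fd_sum_eq_poly'\<close> evaluates the simple poles. Everything is expressed in the coordinate
  \<open>y = 1 - x\<close>, so residues change sign and the exceptional pole is the origin.
\<close>

unbundle no vec_syntax
unbundle fps_syntax

section \<open>A sum of residues\<close>

text \<open>
  Lagrange interpolation at the roots of \<open>R\<close> reproduces \<open>V\<close>, and the coefficient of degree
  \<open>degree R - 1\<close> of the interpolant is the sum on the left. This is Euler's identity.
\<close>

lemma sum_over_simple_roots:
  fixes V R :: "complex poly"
  assumes R: "rsquarefree R" and deg: "degree V < degree R"
  shows "(\<Sum>z | poly R z = 0. poly V z / poly (pderiv R) z)
       = coeff V (degree R - 1) / lead_coeff R"
proof -
  define S where "S = {z. poly R z = 0}"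
  define l where "l = lead_coeff R"
  define L where "L z = (\<Prod>b\<in>S - {z}. [:-b, 1:])" for z
  have R0: "R \<noteq> 0" using deg by auto
  have fin: "finite S" unfolding S_def by (rule poly_roots_finite[OF R0])
  have l0: "l \<noteq> 0" using R0 by (simp add: l_def)
  have decomp: "R = smult l (\<Prod>z\<in>S. [:-z, 1:])"
    using complex_poly_decompose_rsquarefree[OF R] by (simp add: S_def l_def)
  have cardS: "degree R = card S"
    using l0 by (subst decomp) (simp add: degree_prod_sum_eq)
  have degL: "degree (L z) = card S - 1" if "z \<in> S" for z
    using that fin by (simp add: L_def degree_prod_sum_eq)
  have leadL: "coeff (L z) (card S - 1) = 1" if "z \<in> S" for z
    using degL[OF that] lead_coeff_prod[of "\<lambda>b. [:-b, 1:]" "S - {z}"] by (simp add: L_def)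
  have Lroot: "poly (L z) b = 0" if "b \<in> S" "b \<noteq> z" for b z
    using that fin by (auto simp: L_def poly_prod prod_zero_iff)
  have deriv: "poly (pderiv R) z = l * poly (L z) z" if "z \<in> S" for z
  proof -
    have "poly (pderiv R) z = l * (\<Sum>b\<in>S. poly (L b) z)"
      by (subst decomp) (simp add: pderiv_smult pderiv_prod poly_sum L_def pderiv_pCons)
    also have "(\<Sum>b\<in>S. poly (L b) z) = (\<Sum>b\<in>{z}. poly (L b) z)"
      using that fin Lroot by (intro sum.mono_neutral_right) force+
    finally show ?thesis by simp
  qed
  have deriv0: "poly (pderiv R) z \<noteq> 0" if "z \<in> S" for z
    using R that by (auto simp: rsquarefree_roots S_def)
  (* The Lagrange interpolant of V. *)
  define W where "W = (\<Sum>z\<in>S. smult (poly V z / poly (pderiv R) z) (smult l (L z)))"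
  have "W = V"
  proof (rule poly_eqI_degree[of S])
    fix x assume x: "x \<in> S"
    have "poly W x = (\<Sum>z\<in>S. poly V z / poly (pderiv R) z * (l * poly (L z) x))"
      by (simp add: W_def poly_sum mult.assoc)
    also have "\<dots> = (\<Sum>z\<in>{x}. poly V z / poly (pderiv R) z * (l * poly (L z) x))"
      using x fin Lroot by (intro sum.mono_neutral_right) force+
    also have "\<dots> = poly V x"
      using deriv[OF x] deriv0[OF x] by simp
    finally show "poly W x = poly V x" .
  next
    show "degree V < card S" using deg cardS by simp
    have "degree W \<le> card S - 1"
      unfolding W_def using degL fin
      by (intro degree_sum_le) (auto intro: order_trans[OF degree_smult_le])
    then show "degree W < card S" using deg cardS by simp
  qed
  have "coeff W (card S - 1)
      = (\<Sum>z\<in>S. poly V z / poly (pderiv R) z * (l * coeff (L z) (card S - 1)))"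
    by (simp add: W_def coeff_sum mult.assoc)
  also have "\<dots> = (\<Sum>z\<in>S. poly V z / poly (pderiv R) z * l)"
    using leadL by (intro sum.cong) auto
  also have "\<dots> = l * (\<Sum>z\<in>S. poly V z / poly (pderiv R) z)"
    by (subst sum_distrib_left) (simp only: mult.commute)
  finally show ?thesis
    using l0 \<open>W = V\<close> by (simp add: cardS S_def l_def)
qed

abbreviation cpoly :: "rat poly \<Rightarrow> complex poly" where
  "cpoly \<equiv> map_poly of_rat"

lemma cpoly_add: "cpoly (p + q) = cpoly p + cpoly q"
  by (rule poly_eqI) (simp add: coeff_map_poly of_rat_add)

lemma cpoly_mult: "cpoly (p * q) = cpoly p * cpoly q"
  by (rule poly_eqI) (simp add: coeff_map_poly coeff_mult of_rat_sum of_rat_mult)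

lemma cpoly_power: "cpoly (p ^ n) = cpoly p ^ n"
  by (induction n) (simp_all add: cpoly_mult)

lemma cpoly_prod: "cpoly (prod f A) = (\<Prod>i\<in>A. cpoly (f i))"
  by (induction A rule: infinite_finite_induct) (simp_all add: cpoly_mult)

lemma cpoly_sum: "cpoly (sum f A) = (\<Sum>i\<in>A. cpoly (f i))"
  by (induction A rule: infinite_finite_induct) (simp_all add: cpoly_add)

lemma cpoly_pcompose: "cpoly (pcompose p q) = pcompose (cpoly p) (cpoly q)"
  by (induction p) (simp_all add: pcompose_pCons cpoly_add cpoly_mult map_poly_pCons)

lemma degree_cpoly: "degree (cpoly p) = degree p"
  by (rule degree_map_poly) simp

text \<open>
  The residues of \<open>P / (y ^ M * R)\<close> add up to zero. The degree condition says that there is no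
  residue at infinity, the left-hand side collects the simple poles, and the coefficient on the
  right is the residue at \<open>y = 0\<close>. The proof splits off the principal part at \<open>0\<close>: if \<open>U\<close> is the
  power series \<open>P / R\<close> truncated to degree below \<open>M\<close>, then \<open>P = U * R + y ^ M * V\<close> for a
  polynomial \<open>V\<close>. Since \<open>P\<close> has small degree, the top coefficients of \<open>U * R\<close> and \<open>y ^ M * V\<close>
  cancel, and Euler's identity for \<open>V / R\<close> finishes the argument.
\<close>

lemma sum_of_residues:
  fixes P R :: "rat poly"
  assumes R: "rsquarefree (cpoly R)" and R0: "coeff R 0 \<noteq> 0"
    and R_nonconst: "degree R > 0" and M: "M > 0" and deg: "degree P + 2 \<le> M + degree R"
  shows "(\<Sum>z | poly (cpoly R) z = 0. poly (cpoly P) z / (z ^ M * poly (pderiv (cpoly R)) z))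
       = - of_rat ((fps_of_poly P / fps_of_poly R) $ (M - 1))"
proof -
  define u where "u = fps_of_poly P / fps_of_poly R"
  define U where "U = Poly (map (fps_nth u) [0..<M])"
  have coeffU: "coeff U i = (if i < M then u $ i else 0)" for i
    by (simp add: U_def nth_default_def)
  have degU: "degree U \<le> M - 1"
    by (rule degree_le) (auto simp: coeffU)
  have "u * fps_of_poly R = fps_of_poly P"
    using R0 by (simp add: u_def fps_divide_unit inverse_mult_eq_1 mult.assoc)
  then have P_coeff: "coeff P i = (\<Sum>j=0..i. u $ j * coeff R (i - j))" for i
    by (metis (no_types, lifting) fps_mult_nth fps_of_poly_nth sum.cong)
  have "monom 1 M dvd P - U * R"
    unfolding monom_1_dvd_iff'
  proof (intro allI impI)
    fix i assume "i < M"
    then have "coeff (U * R) i = (\<Sum>j=0..i. u $ j * coeff R (i - j))"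
      by (simp add: coeff_mult coeffU atMost_atLeast0)
    then show "coeff (P - U * R) i = 0" by (simp add: P_coeff)
  qed
  then obtain V where "P - U * R = monom 1 M * V" by (elim dvdE)
  then have PUV: "P = U * R + monom 1 M * V" by (simp add: algebra_simps)
  have coeffP: "coeff P (M + i) = coeff (U * R) (M + i) + coeff V i" for i
    by (subst PUV) (simp add: coeff_monom_mult)
  have coeffUR: "coeff (U * R) i = 0" if "i \<ge> M + degree R" for i
    using degree_mult_le[of U R] degU M that by (intro coeff_eq_0) linarith
  have "coeff V i = 0" if "i \<ge> degree R" for i
    using coeffP[of i] coeffUR[of "M + i"] that deg by (simp add: coeff_eq_0)
  then have degV: "degree V < degree R"
    using R_nonconst by (metis leading_coeff_0_iff degree_0 not_le)
  have "coeff (U * R) (M - 1 + degree R) = u $ (M - 1) * lead_coeff R"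
  proof (cases "degree U = M - 1")
    case True
    with coeff_mult_degree_sum[of U R] show ?thesis using M by (simp add: coeffU)
  next
    case False
    then have "degree U < M - 1" using degU by simp
    then have "coeff U (M - 1) = 0" "degree (U * R) < M - 1 + degree R"
      using degree_mult_le[of U R] by (auto simp: coeff_eq_0)
    then show ?thesis using M by (auto simp: coeff_eq_0 coeffU)
  qed
  then have topV: "coeff V (degree R - 1) = - u $ (M - 1) * lead_coeff R"
    using coeffP[of "degree R - 1"] R_nonconst M deg by (simp add: coeff_eq_0)
  have root: "poly (cpoly P) z / (z ^ M * poly (pderiv (cpoly R)) z)
      = poly (cpoly V) z / poly (pderiv (cpoly R)) z" if "poly (cpoly R) z = 0" for z
  proof -
    have "z \<noteq> 0"
      using that R0 by (auto simp: poly_0_coeff_0 coeff_map_poly)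
    moreover have "poly (cpoly P) z = z ^ M * poly (cpoly V) z"
      using that by (subst PUV) (simp add: cpoly_add cpoly_mult map_poly_monom poly_monom)
    ultimately show ?thesis by simp
  qed
  have "(\<Sum>z | poly (cpoly R) z = 0. poly (cpoly P) z / (z ^ M * poly (pderiv (cpoly R)) z))
      = (\<Sum>z | poly (cpoly R) z = 0. poly (cpoly V) z / poly (pderiv (cpoly R)) z)"
    by (intro sum.cong) (use root in auto)
  also have "\<dots> = of_rat (coeff V (degree R - 1)) / of_rat (lead_coeff R)"
    using sum_over_simple_roots[OF R, of "cpoly V"] degV
    by (simp add: degree_cpoly coeff_map_poly)
  also have "\<dots> = - of_rat (u $ (M - 1))"
    using R_nonconst by (subst topV) (auto simp: of_rat_mult of_rat_minus)
  finally show ?thesis by (simp add: u_def)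
qed

section \<open>Geometric sums as polynomials in 1 - x\<close>

text \<open>
  This is \<open>(1 - x ^ n) / (1 - x) = 1 + x + \<dots> + x ^ (n - 1)\<close> as a polynomial in \<open>y = 1 - x\<close>: the
  point \<open>x = 1\<close>, where power series expansions are taken, becomes the origin.
\<close>

definition geo :: "nat \<Rightarrow> 'a::comm_ring_1 poly" where
  "geo n = (\<Sum>i<n. [:1, -1:] ^ i)"

lemma X_mult_geo: "[:0, 1:] * geo n = 1 - [:1, -1:] ^ n"
proof -
  have "[:0, 1:] = (1 - [:1, -1:] :: 'a poly)"
    by (simp add: one_pCons)
  then show ?thesis
    unfolding geo_def by (simp only: one_diff_power_eq)
qed

lemma poly_geo: "poly (geo n) (1 - w) = (\<Sum>i<n. w ^ i)"
  by (simp add: geo_def poly_sum poly_power)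

lemma poly_geo': "(1 - w) * poly (geo n) (1 - w) = 1 - w ^ n"
  by (simp add: poly_geo one_diff_power_eq)

lemma coeff_0_geo: "coeff (geo n) 0 = of_nat n"
  using poly_geo[of n 1] by (simp add: poly_0_coeff_0)

lemma geo_nonzero: "n > 0 \<Longrightarrow> geo n \<noteq> (0 :: 'a::{comm_ring_1,ring_char_0} poly)"
  by (metis coeff_0 coeff_0_geo of_nat_eq_0_iff less_irrefl)

lemma degree_geo: "n > 0 \<Longrightarrow> degree (geo n :: 'a::{idom,ring_char_0} poly) = n - 1"
proof -
  assume n: "n > 0"
  have "Suc (degree (geo n :: 'a poly)) = degree ([:0, 1:] * geo n :: 'a poly)"
    using geo_nonzero[OF n, where 'a = 'a] by (subst degree_mult_eq) auto
  also have "\<dots> = degree ([:1, -1:] ^ n - 1 :: 'a poly)"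
    by (metis X_mult_geo degree_minus minus_diff_eq)
  also have "\<dots> = n"
    using n degree_add_eq_left[of "-1" "[:1, -1:] ^ n :: 'a poly"] by simp
  finally show ?thesis by simp
qed

lemma cpoly_geo: "cpoly (geo n) = geo n"
  by (simp add: geo_def cpoly_sum cpoly_power map_poly_pCons of_rat_minus)

lemma geo_dvd_geo_mult: "geo a dvd (geo (a * b) :: 'a::idom poly)"
proof -
  have "1 - [:1, -1:] ^ a dvd (1 - [:1, -1:] ^ (a * b) :: 'a poly)"
    using one_diff_power_eq[of "[:1, -1:] ^ a :: 'a poly" b] by (simp add: power_mult)
  then have "[:0, 1:] * geo a dvd ([:0, 1:] * geo (a * b) :: 'a poly)"
    by (simp only: X_mult_geo)
  then show ?thesis by (subst (asm) dvd_mult_cancel_left) simp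
qed

text \<open>
  From \<open>a * u = b * v + 1\<close> follows \<open>(1 - x ^ (a * u)) - x * (1 - x ^ (b * v)) = 1 - x\<close>, which is a
  Bezout identity after division by \<open>1 - x\<close>.
\<close>

lemma coprime_geo:
  assumes "coprime a b" "a > 0"
  shows "coprime (geo a) (geo b :: 'a::field poly)"
proof (rule coprimeI)
  fix c :: "'a poly"
  assume c: "c dvd geo a" "c dvd geo b"
  obtain u v where uv: "a * u = b * v + 1"
    using bezout_add_strong_nat[of a b] assms by (metis coprime_iff_gcd_eq_1 bezout_nat gcd.commute less_irrefl)
  have "[:0, 1:] * (geo (a * u) - [:1, -1:] * geo (b * v)) = ([:0, 1:] :: 'a poly)"
  proof -
    have "[:0, 1:] * (geo (a * u) - [:1, -1:] * geo (b * v))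
      = [:0, 1:] * geo (a * u) - [:1, -1:] * ([:0, 1:] * geo (b * v) :: 'a poly)"
      by (simp only: algebra_simps)
    also have "\<dots> = 1 - [:1, -1:] ^ (a * u) - [:1, -1:] * (1 - [:1, -1:] ^ (b * v))"
      by (simp only: X_mult_geo)
    also have "\<dots> = 1 - [:1, -1:]"
      by (simp only: uv power_add power_one_right) (simp add: algebra_simps)
    finally show ?thesis by (simp add: one_pCons)
  qed
  then have "geo (a * u) - [:1, -1:] * geo (b * v) = (1 :: 'a poly)"
    by (subst (asm) mult_cancel_left2) auto
  moreover have "c dvd geo (a * u)" "c dvd geo (b * v)"
    using c geo_dvd_geo_mult by (blast intro: dvd_trans)+
  ultimately show "is_unit c" by (metis dvd_diff dvd_mult)
qed

text \<open>
  Pairwise coprime divisors of \<open>geo N\<close> have a product that divides it. In terms of \<open>x\<close>: distinct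
  \<open>1 - x ^ n i\<close> share no zero but \<open>1\<close>, so a single factor \<open>1 - x ^ N\<close> lowers the order of every pole of
  \<open>F\<close> at a root of unity by one, and \<open>r - 1\<close> of them leave simple poles.
\<close>

lemma prod_geo_dvd:
  fixes n :: "nat \<Rightarrow> nat"
  assumes "finite A" "pairwise (\<lambda>i j. coprime (n i) (n j)) A" "\<And>i. i \<in> A \<Longrightarrow> n i > 0"
  shows "(\<Prod>i\<in>A. geo (n i)) dvd (geo (\<Prod>i\<in>A. n i) :: rat poly)"
  using assms
proof (induction A rule: finite_induct)
  case (insert j A)
  have "coprime (geo (n j)) (\<Prod>i\<in>A. geo (n i) :: rat poly)"
  proof (rule prod_coprime_right)
    fix i assume "i \<in> A"
    then have "coprime (n j) (n i)"
      using insert.hyps insert.prems by (auto simp: pairwise_insert)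
    then show "coprime (geo (n j)) (geo (n i) :: rat poly)"
      using insert.prems by (intro coprime_geo) auto
  qed
  moreover have "(\<Prod>i\<in>A. geo (n i)) dvd (geo (n j * (\<Prod>i\<in>A. n i)) :: rat poly)"
    using insert geo_dvd_geo_mult[of "\<Prod>i\<in>A. n i" "n j"]
    by (auto simp: pairwise_insert mult.commute intro: dvd_trans)
  ultimately show ?case
    using insert.hyps geo_dvd_geo_mult by (auto intro!: divides_mult)
qed (simp add: geo_def)

text \<open>Differentiate \<open>y * geo n = 1 - x ^ n\<close> at a root \<open>x = w\<close>, where \<open>geo n\<close> vanishes.\<close>

lemma poly_pderiv_geo:
  fixes w :: complex
  assumes "w ^ n = 1" "w \<noteq> 1" "n > 0"
  shows "w * ((1 - w) * poly (pderiv (geo n)) (1 - w)) = of_nat n"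
proof -
  have root: "poly (geo n) (1 - w) = 0"
    using poly_geo'[of w n] assms by simp
  have "poly (pderiv ([:0, 1:] * geo n)) (1 - w) = poly (pderiv (1 - [:1, -1:] ^ n)) (1 - w)"
    by (simp only: X_mult_geo)
  then have "(1 - w) * poly (pderiv (geo n)) (1 - w) = of_nat n * w ^ (n - 1)"
    using root by (simp add: pderiv_mult pderiv_diff pderiv_power pderiv_pCons poly_power del: mult_pCons_left)
  then show ?thesis
    using assms by (metis mult.commute mult.left_commute mult.right_neutral power_minus_mult)
qed

section \<open>Expansion at the pole 1\<close>

lemma fps_of_poly_one_minus_X: "fps_of_poly [:1, -1:] = (1 - fps_X :: 'a::comm_ring_1 fps)"
  by (simp add: fps_of_poly_pCons)

lemma X_mult_fps_geo: "fps_X * fps_of_poly (geo n) = 1 - (1 - fps_X :: 'a::comm_ring_1 fps) ^ n"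
proof -
  have "fps_of_poly ([:0, 1:] * geo n :: 'a poly) = fps_of_poly (1 - [:1, -1:] ^ n)"
    by (simp only: X_mult_geo)
  moreover have "fps_of_poly [:0, 1:] = (fps_X :: 'a fps)"
    by (simp add: fps_of_poly_pCons)
  ultimately show ?thesis
    by (simp only: fps_of_poly_mult fps_of_poly_diff fps_of_poly_power fps_of_poly_1
        fps_of_poly_one_minus_X)
qed

lemma beta_gf_eq:
  assumes "n > 0"
  shows "beta_gf r n = (of_nat n * inverse (fps_of_poly (geo n))) ^ r"
proof -
  have "of_nat n * fps_X / (1 - (1 - fps_X) ^ n) = fps_X * of_nat n / (fps_X * fps_of_poly (geo n) :: rat fps)"
    by (simp only: X_mult_fps_geo mult.commute)
  also have "\<dots> = of_nat n / fps_of_poly (geo n)"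
    by (rule div_mult_mult1) simp
  also have "\<dots> = of_nat n * inverse (fps_of_poly (geo n))"
    using assms by (intro fps_divide_unit) (simp add: coeff_0_geo)
  finally show ?thesis by (simp add: beta_gf_def)
qed

lemma higher_pderiv_pcompose_one_minus:
  "(pderiv ^^ i) (pcompose p [:1, -1:]) = smult ((-1) ^ i) (pcompose ((pderiv ^^ i) p) [:1, -1:])"
  by (induction i) (simp_all add: pderiv_smult pderiv_pcompose pderiv_pCons mult.commute)

lemma coeff_pcompose_one_minus:
  fixes p :: "'a::field_char_0 poly"
  shows "coeff (pcompose p [:1, -1:]) i = (-1) ^ i * (poly ((pderiv ^^ i) p) 1 / fact i)"
proof -
  have "fact i * coeff (pcompose p [:1, -1:]) i = coeff ((pderiv ^^ i) (pcompose p [:1, -1:])) 0"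
    by (simp add: coeff_higher_pderiv pochhammer_fact)
  also have "\<dots> = (-1) ^ i * poly ((pderiv ^^ i) p) 1"
    by (simp add: higher_pderiv_pcompose_one_minus poly_pcompose flip: poly_0_coeff_0)
  finally show ?thesis by (simp add: field_simps)
qed

text \<open>
  With \<open>y = 1 - x\<close>, this is the Taylor series at \<open>y = 0\<close> of
  \<open>(1 - x) ^ (m + r * k) * F x\<close>, that is, of \<open>F\<close> with its pole at \<open>x = 1\<close> removed.
\<close>

definition pole_series :: "nat \<Rightarrow> rat poly \<Rightarrow> nat \<Rightarrow> (nat \<Rightarrow> nat) \<Rightarrow> rat fps" where
  "pole_series r p k n =
     fps_of_poly (pcompose p [:1, -1:]) * inverse (fps_of_poly (\<Prod>l = 1..k. geo (n l))) ^ r"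

lemma fps_inverse_prod: "inverse (prod f A) = (\<Prod>i\<in>A. inverse (f i :: 'a::field fps))"
  by (induction A rule: infinite_finite_induct) (simp_all add: fps_inverse_mult)

text \<open>
  The sum over \<open>natpermute j (k + 1)\<close> is the Cauchy product of the Taylor series of \<open>p\<close> with the
  \<open>k\<close> series \<open>beta_gf\<close>; the signs \<open>(- 1) ^ i\<close> of the factors multiply to \<open>(- 1) ^ j\<close>.
\<close>

lemma pp_coeff_eq:
  assumes "\<And>l. l \<in> {1..k} \<Longrightarrow> n l > 0"
  shows "pp_coeff r p k n j = pole_series r p k n $ j"
proof -
  define a where "a l = (if l = 0 then fps_of_poly (pcompose p [:1, -1:]) else beta_gf r (n l))" for l
  define Q where "Q = (\<Prod>l = 1..k. n l)"
  have split: "(\<Prod>l=0..k. f l) = f 0 * (\<Prod>l=1..k. f l)" for f :: "nat \<Rightarrow> 'b::comm_monoid_mult"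
    by (simp add: prod.atLeast_Suc_atMost)
  have Q0: "Q \<noteq> 0" using assms by (fastforce simp: Q_def)
  have "(\<Prod>l=1..k. a l) = (\<Prod>l=1..k. (of_nat (n l) * inverse (fps_of_poly (geo (n l)))) ^ r)"
    by (intro prod.cong) (use assms in \<open>auto simp: a_def beta_gf_eq\<close>)
  also have "\<dots> = of_nat Q ^ r * inverse (fps_of_poly (\<Prod>l=1..k. geo (n l))) ^ r"
    by (simp add: Q_def prod_power_distrib prod.distrib power_mult_distrib fps_inverse_prod
        fps_of_poly_prod)
  finally have "(\<Prod>l=0..k. a l) = fps_const (of_nat Q ^ r) * pole_series r p k n"
    unfolding split by (simp add: a_def pole_series_def mult_ac fps_const_power flip: fps_of_nat)
  then have "of_nat Q ^ r * pole_series r p k n $ j = (\<Prod>l=0..k. a l) $ j"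
    by simp
  also have "\<dots> = (\<Sum>i\<in>natpermute j (k + 1). \<Prod>l=0..k. a l $ (i ! l))"
    by (rule fps_prod_nth)
  also have "\<dots> = (\<Sum>i\<in>natpermute j (k + 1).
        (- 1) ^ j * (poly ((pderiv ^^ (i ! 0)) p) 1 / fact (i ! 0))
          * (\<Prod>l = 1..k. beta r (i ! l) (n l) / fact (i ! l)))"
  proof (rule sum.cong)
    fix i assume "i \<in> natpermute j (k + 1)"
    then have len: "length i = Suc k" and "sum_list i = j"
      by (auto simp: natpermute_def)
    then have j: "j = i ! 0 + (\<Sum>l=1..k. i ! l)"
      by (simp add: sum_list_sum_nth atLeastLessThanSuc_atLeastAtMost sum.atLeast_Suc_atMost
          del: sum.op_ivl_Suc)
    have "(\<Prod>l=1..k. a l $ (i ! l)) = (\<Prod>l=1..k. (-1) ^ (i ! l) * (beta r (i ! l) (n l) / fact (i ! l)))"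
      by (intro prod.cong) (auto simp: a_def beta_def simp flip: power_mult_distrib)
    also have "\<dots> = (-1) ^ (\<Sum>l=1..k. i ! l) * (\<Prod>l=1..k. beta r (i ! l) (n l) / fact (i ! l))"
      by (simp only: prod.distrib power_sum)
    finally show "(\<Prod>l=0..k. a l $ (i ! l)) =
        (- 1) ^ j * (poly ((pderiv ^^ (i ! 0)) p) 1 / fact (i ! 0))
          * (\<Prod>l = 1..k. beta r (i ! l) (n l) / fact (i ! l))"
      unfolding split by (subst j) (simp add: a_def coeff_pcompose_one_minus power_add)
  qed simp
  also have "\<dots> = of_nat Q ^ r * pp_coeff r p k n j"
    using Q0 unfolding pp_coeff_def Q_def [symmetric] by simp
  finally show ?thesis
    using Q0 by simp
qed

text \<open>
  In terms of \<open>x = 1 - y\<close> the series is \<open>x powi (a - 1)\<close>. Writing it as a quotient covers \<open>a = 0\<close>,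
  and the upper argument \<open>i - a\<close> makes the coefficient the value at \<open>- a\<close> of the polynomial in \<open>u\<close>
  that gives the coefficient of \<open>x ^ u\<close> in \<open>1 / (1 - x) ^ (i + 1)\<close>.
\<close>

lemma fps_nth_one_minus_X_power:
  "((1 - fps_X) ^ a * inverse (1 - fps_X)) $ i = ((of_nat i - of_nat a :: 'a::field_char_0) gchoose i)"
proof (induction a arbitrary: i)
  case 0
  have "inverse (1 - fps_X :: 'a fps) = Abs_fps (\<lambda>_. 1)"
    using fps_inverse_idempotent[of "Abs_fps (\<lambda>_. 1 :: 'a)"] by (simp add: fps_inverse_gp')
  then show ?case by (simp flip: binomial_gbinomial)
next
  case (Suc a)
  let ?f = "(1 - fps_X) ^ a * inverse (1 - fps_X) :: 'a fps"
  have eq: "(1 - fps_X) ^ Suc a * inverse (1 - fps_X) = ?f - fps_X * ?f"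
    by (simp add: algebra_simps)
  show ?case
  proof (cases i)
    case 0
    then show ?thesis unfolding eq by (simp add: fps_nth_power_0)
  next
    case (Suc i')
    have "(of_nat i - of_nat a :: 'a) gchoose i
        = ((of_nat i' - of_nat a) gchoose i') + ((of_nat i' - of_nat a) gchoose i)"
      using gbinomial_Suc_Suc[of "of_nat i' - of_nat a :: 'a" i'] Suc by (simp add: algebra_simps)
    then show ?thesis unfolding eq using Suc.IH[of i] Suc.IH[of i'] Suc
      by (simp add: algebra_simps)
  qed
qed

text \<open>
  The coefficient on the right belongs to \<open>y ^ -1\<close> in \<open>x powi (t - 1) * (1 - x ^ N) ^ (r - 1) * F x\<close>.
  Each shift of \<open>t\<close> by \<open>q * N\<close> in \<open>poly'\<close> comes from the term \<open>x ^ (q * N)\<close> in the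
  binomial expansion of \<open>(1 - x ^ N) ^ (r - 1)\<close>.
\<close>

lemma poly'_eq:
  fixes k :: nat and t :: nat
  assumes pos: "\<And>l. l \<in> {1..k} \<Longrightarrow> n l > 0" and K: "m + r * k > 0" and r: "r > 0"
  defines "N \<equiv> \<Prod>l = 1..k. n l"
  shows "poly' m r p k n (- of_nat t)
       = ((1 - fps_X) ^ t * inverse (1 - fps_X) * (1 - (1 - fps_X) ^ N) ^ (r - 1) * pole_series r p k n)
           $ (m + r * k - 1)"
proof -
  define K where "K = m + r * k"
  define A where "A = pole_series r p k n"
  define B :: "nat \<Rightarrow> rat fps" where "B a = (1 - fps_X) ^ a * inverse (1 - fps_X)" for a
  have pp: "pp_coeff r p k n j = A $ j" for j
    unfolding A_def using pos by (rule pp_coeff_eq)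
  have interval: "{..<K} = {0..K - 1}"
    using K unfolding K_def [symmetric] by (cases K) auto
  have W1: "W1 m r p k n (- of_nat t - of_nat (q * N)) = (B (t + q * N) * A) $ (K - 1)" for q
  proof -
    have "W1 m r p k n (- of_nat t - of_nat (q * N))
        = (\<Sum>j<K. A $ j * ((of_nat (K - 1 - j) - of_nat (t + q * N)) gchoose (K - 1 - j)))"
      unfolding W1_def K_def [symmetric]
      by (intro sum.cong) (auto simp: pp algebra_simps)
    also have "\<dots> = (\<Sum>j = 0..K - 1. A $ j * B (t + q * N) $ (K - 1 - j))"
      unfolding B_def fps_nth_one_minus_X_power by (intro sum.cong interval) auto
    finally show ?thesis by (simp only: fps_mult_nth mult.commute[of _ A])
  qed
  have "(1 - (1 - fps_X :: rat fps) ^ N) ^ (r - 1)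
      = (\<Sum>q\<le>r - 1. of_nat ((r - 1) choose q) * (- ((1 - fps_X) ^ N)) ^ q)"
    using binomial_ring[of "- ((1 - fps_X :: rat fps) ^ N)" 1 "r - 1"] by simp
  also have "\<dots> = (\<Sum>q\<le>r - 1. fps_const (of_nat ((r - 1) choose q) * (-1) ^ q) * (1 - fps_X) ^ (q * N))"
  proof (intro sum.cong refl)
    fix q
    have "fps_const (of_nat ((r - 1) choose q) * (-1) ^ q) = (of_nat ((r - 1) choose q) * (-1) ^ q :: rat fps)"
      by (simp flip: fps_const_mult fps_const_power fps_const_neg fps_of_nat)
    then show "of_nat ((r - 1) choose q) * (- ((1 - fps_X) ^ N)) ^ q
        = fps_const (of_nat ((r - 1) choose q) * (-1) ^ q) * (1 - fps_X :: rat fps) ^ (q * N)"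
      by (simp add: power_minus[of "(1 - fps_X) ^ N"] mult.commute[of q] power_mult mult.assoc)
  qed
  finally have "B t * (1 - (1 - fps_X) ^ N) ^ (r - 1) * A
      = (\<Sum>q\<le>r - 1. fps_const (of_nat ((r - 1) choose q) * (-1) ^ q) * (B (t + q * N) * A))"
    by (simp add: B_def sum_distrib_left sum_distrib_right power_add mult_ac)
  then have "(B t * (1 - (1 - fps_X) ^ N) ^ (r - 1) * A) $ (K - 1) = poly' m r p k n (- of_nat t)"
    unfolding poly'_def N_def [symmetric] W1 by (simp add: fps_sum_nth atMost_atLeast0)
  then show ?thesis by (simp add: B_def A_def K_def)
qed

text \<open>
  Cancelling \<open>(1 - x ^ N) ^ (r - 1) = (y * \<Phi> * E) ^ (r - 1)\<close> against the denominator of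
  \<open>x powi (t - 1) * F x\<close> leaves \<open>P / (y ^ M * R)\<close> with \<open>M = m + r * (k - 1) + 1\<close>. The factor \<open>x\<close> of
  \<open>R\<close> stands for the exponent \<open>- 1\<close>.
\<close>

lemma poly'_eq_residue:
  fixes k r t :: nat and n :: "nat \<Rightarrow> nat" and E p :: "rat poly"
  defines "\<Phi> \<equiv> \<Prod>i = 1..k. geo (n i)" and "N \<equiv> \<Prod>i = 1..k. n i"
  defines "P \<equiv> pcompose p [:1, -1:] * [:1, -1:] ^ t * E ^ (r - 1)"
    and "R \<equiv> [:1, -1:] * \<Phi>"
  assumes k: "k \<ge> 1" and r: "r \<ge> 1" and pos: "\<And>l. l \<in> {1..k} \<Longrightarrow> n l > 0"
    and E: "geo N = \<Phi> * E"
  shows "(fps_of_poly P / fps_of_poly R) $ (m + r * (k - 1)) = poly' m r p k n (- of_nat t)"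
proof -
  have npos: "n l > 0" if "l \<in> {1..k}" for l using pos[OF that] .
  have coeff_R: "coeff R 0 \<noteq> 0"
    using npos by (simp add: R_def \<Phi>_def poly_prod flip: poly_0_coeff_0)
      (simp add: poly_0_coeff_0 coeff_0_geo)
  define \<phi> where "\<phi> = fps_of_poly \<Phi>"
  define \<epsilon> where "\<epsilon> = fps_of_poly E"
  have \<phi>0: "\<phi> $ 0 \<noteq> 0" using coeff_R by (auto simp: \<phi>_def R_def coeff_mult)
  have \<phi>_inv: "\<phi> ^ (r - 1) * inverse \<phi> ^ r = inverse \<phi>"
  proof -
    have "\<phi> ^ (r - 1) * inverse \<phi> ^ r = (\<phi> * inverse \<phi>) ^ (r - 1) * inverse \<phi>"
      using r by (cases r) (simp_all add: power_mult_distrib)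
    then show ?thesis using \<phi>0 by (simp add: inverse_mult_eq_1')
  qed
  have X: "1 - (1 - fps_X) ^ N = fps_X * (\<phi> * \<epsilon>)"
    by (simp add: \<phi>_def \<epsilon>_def E flip: X_mult_fps_geo fps_of_poly_mult)
  have PR: "fps_of_poly P / fps_of_poly R = fps_of_poly (pcompose p [:1, -1:]) * (1 - fps_X) ^ t * \<epsilon> ^ (r - 1)
      * (inverse (1 - fps_X) * inverse \<phi>)"
  proof -
    have "fps_of_poly R = (1 - fps_X) * \<phi>"
      by (simp only: R_def fps_of_poly_mult fps_of_poly_one_minus_X \<phi>_def)
    moreover have "fps_of_poly P = fps_of_poly (pcompose p [:1, -1:]) * (1 - fps_X) ^ t * \<epsilon> ^ (r - 1)"
      by (simp only: P_def fps_of_poly_mult fps_of_poly_power fps_of_poly_one_minus_X \<epsilon>_def)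
    ultimately show ?thesis
      using \<phi>0 by (simp add: fps_divide_unit fps_inverse_mult)
  qed
  have "(1 - fps_X) ^ t * inverse (1 - fps_X) * (1 - (1 - fps_X) ^ N) ^ (r - 1) * pole_series r p k n
      = fps_X ^ (r - 1) * (fps_of_poly (pcompose p [:1, -1:]) * (1 - fps_X) ^ t * \<epsilon> ^ (r - 1)
          * (inverse (1 - fps_X) * (\<phi> ^ (r - 1) * inverse \<phi> ^ r)))"
    unfolding X by (simp add: pole_series_def power_mult_distrib mult_ac \<phi>_def \<Phi>_def)
  also have "\<dots> = fps_X ^ (r - 1) * (fps_of_poly P / fps_of_poly R)"
    by (simp only: PR \<phi>_inv)
  finally have "poly' m r p k n (- of_nat t) = (fps_X ^ (r - 1) * (fps_of_poly P / fps_of_poly R)) $ (m + r * k - 1)"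
    using poly'_eq[of k n m r p t] npos k r by (simp add: N_def)
  moreover have "m + r * k - 1 = (r - 1) + (m + r * (k - 1))"
    using k r by (cases k; cases r) auto
  ultimately show ?thesis by (simp add: fps_X_power_mult_nth)
qed

section \<open>Sums over roots of unity\<close>

lemma sum_roots_of_unity_eq:
  fixes f :: "complex \<Rightarrow> 'a::comm_monoid_add"
  assumes "b > 0"
  shows "(\<Sum>j = 1..b - 1. f (exp (2 * of_real pi * \<i> / of_nat b) ^ j))
       = (\<Sum>w | w ^ b = 1 \<and> w \<noteq> 1. f w)"
proof -
  have eq: "exp (2 * of_real pi * \<i> / of_nat b) ^ j = cis (2 * pi * real j / real b)" for j
    by (simp add: cis_conv_exp flip: exp_of_nat_mult) (simp add: mult_ac)
  have "bij_betw (\<lambda>k. cis (2 * pi * real k / real b)) ({..<b} - {0}) ({z. z ^ b = 1} - {1})"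
    using Complex.bij_betw_roots_unity[OF assms] assms
    by (intro bij_betw_DiffI) auto
  moreover have "{..<b} - {0} = {1..b - 1}" using assms by auto
  moreover have "{z. z ^ b = 1} - {1} = {w :: complex. w ^ b = 1 \<and> w \<noteq> 1}" by auto
  ultimately have "bij_betw (\<lambda>k. cis (2 * pi * real k / real b)) {1..b - 1}
      {w. w ^ b = 1 \<and> w \<noteq> 1}" by simp
  from sum.reindex_bij_betw[OF this, of f] show ?thesis unfolding eq .
qed

lemma fd_sum_eq:
  assumes "b > 0"
  shows "fd_sum m r p (int t) I n b = 1 / of_nat b ^ r *
    (\<Sum>w | w ^ b = 1 \<and> w \<noteq> 1. poly (cpoly p) w * w ^ t / ((1 - w) ^ m * (\<Prod>i\<in>I. (1 - w ^ n i) ^ r)))"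
  unfolding fd_sum_def Let_def power_int_of_nat
  by (subst sum_roots_of_unity_eq[OF assms]) (rule refl)

lemma coprime_powers_eq_1:
  fixes w :: "'a::comm_monoid_mult"
  assumes "w ^ a = 1" "w ^ b = 1" "coprime a b"
  shows "w = 1"
proof (cases "a = 0")
  case False
  then obtain u v where "a * u = b * v + 1"
    using bezout_nat[of a b] assms(3) by auto
  then have "w ^ (a * u) = w ^ (b * v) * w"
    by (simp add: mult.commute)
  then show ?thesis using assms by (simp add: power_mult)
qed (use assms in simp)

section \<open>Summing the residues\<close>

text \<open>
  The residues of \<open>x powi (t - 1) * (1 - x ^ N) ^ (r - 1) * F x\<close> are added up, all in the coordinate
  \<open>y = 1 - x\<close>, so that the root of unity \<open>x = w\<close> is the point \<open>y = 1 - w\<close>. The bound on \<open>t\<close> is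
  what the degree condition of \<open>sum_of_residues\<close> amounts to.
\<close>

lemma fd_sum_eq_poly':
  fixes k r m t :: nat and n :: "nat \<Rightarrow> nat" and p :: "rat poly"
  assumes k: "k \<ge> 1" and n2: "\<And>i. i \<in> {1..k} \<Longrightarrow> n i \<ge> 2"
    and cop: "pairwise (\<lambda>i j. coprime (n i) (n j)) {1..k}" and r: "r \<ge> 1"
    and N: "N = (\<Prod>i = 1..k. n i)"
    and t: "int t < int m + int r * (\<Sum>i = 1..k. int (n i)) - (int r - 1) * int N - int (degree p)"
  shows "of_nat N ^ (r - 1) * (\<Sum>j = 1..k. fd_sum m r p (int t) ({1..k} - {j}) n (n j))
       = of_rat ((if t = 0 then poly p 0 else 0) - poly' m r p k n (- of_nat t))"
proof -
  define s :: "rat poly" where "s = [:1, -1:]"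
  define \<Phi> where "\<Phi> = (\<Prod>i = 1..k. geo (n i) :: rat poly)"
  have npos: "n i > 0" if "i \<in> {1..k}" for i using n2[OF that] by simp
  have N0: "N > 0" using npos by (auto simp: N intro!: prod_pos)
  have "\<Phi> dvd geo N"
    unfolding \<Phi>_def N by (rule prod_geo_dvd) (use cop npos in auto)
  then obtain E where E: "geo N = \<Phi> * E" by (elim dvdE)
  have \<Phi>0: "\<Phi> \<noteq> 0" and E0: "E \<noteq> 0" using geo_nonzero[OF N0, where 'a = rat] E by auto
  (* The function x ^ (t - 1) (1 - x ^ N) ^ (r - 1) F(x) is P / (y ^ M * R). *)
  define R where "R = s * \<Phi>"
  define P where "P = pcompose p s * s ^ t * E ^ (r - 1)"
  define M where "M = m + r * (k - 1) + 1"

  have coeff_R: "coeff R 0 \<noteq> 0"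
    using npos by (simp add: R_def s_def \<Phi>_def coeff_0_geo poly_prod flip: poly_0_coeff_0)
      (simp add: poly_0_coeff_0 coeff_0_geo)
  define \<sigma> where "\<sigma> = (\<Sum>i = 1..k. n i - 1)"
  have \<sigma>: "\<sigma> + k = (\<Sum>i = 1..k. n i)"
  proof -
    have "\<sigma> + (\<Sum>i = 1..k. 1) = (\<Sum>i = 1..k. n i)"
      unfolding \<sigma>_def sum.distrib [symmetric] using npos by (intro sum.cong) (auto simp: Suc_le_eq)
    then show ?thesis by simp
  qed
  have deg\<Phi>: "degree \<Phi> = \<sigma>"
    unfolding \<Phi>_def \<sigma>_def using npos
    by (subst degree_prod_sum_eq) (auto simp: geo_nonzero degree_geo intro!: sum.cong)
  have degE: "\<sigma> + degree E = N - 1"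
    using degree_geo[OF N0, where 'a = rat] \<Phi>0 E0 by (simp add: E degree_mult_eq deg\<Phi>)
  have degR: "degree R = 1 + \<sigma>"
    using \<Phi>0 degree_mult_eq[of s \<Phi>] by (simp add: R_def deg\<Phi> s_def del: mult_pCons_left)
  have "degree P \<le> degree p + t + (r - 1) * degree E"
  proof -
    have "degree (s ^ t) = t" "degree (E ^ (r - 1)) = (r - 1) * degree E" "degree (pcompose p s) = degree p"
      using E0 by (simp_all add: s_def degree_power_eq degree_pcompose)
    then show ?thesis
      unfolding P_def using degree_mult_le[of "pcompose p s * s ^ t" "E ^ (r - 1)"]
        degree_mult_le[of "pcompose p s" "s ^ t"] by linarith
  qed
  moreover have "degree p + t + (r - 1) * degree E + 2 \<le> M + degree R"
  proof -
    obtain r' where r': "r = Suc r'" using r by (cases r) auto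
    obtain k' where k': "k = Suc k'" using k by (cases k) auto
    have "int N = 1 + int \<sigma> + int (degree E)" using degE N0 by linarith
    moreover have "(\<Sum>i = 1..k. int (n i)) = int \<sigma> + 1 + int k'"
      using \<sigma> by (simp add: k' flip: of_nat_sum)
    ultimately have "int (degree p) + int t + int r' * int (degree E) + 2
        \<le> int m + int r * int k' + 1 + (1 + int \<sigma>)"
      using t by (simp add: r' algebra_simps)
    then show ?thesis by (simp add: M_def degR r' k' algebra_simps flip: of_nat_le_iff[where 'a = int])
  qed
  ultimately have deg: "degree P + 2 \<le> M + degree R" by linarith

  define Z where "Z j = {w :: complex. w ^ n j = 1 \<and> w \<noteq> 1}" for j
  (* The value at x = w of the factors of \<Phi> other than the one that vanishes there. *)
  define cof where "cof j w = (\<Prod>i\<in>{1..k} - {j}. poly (geo (n i)) (1 - w) :: complex)" for j w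
  have s_eval: "poly (cpoly s) (1 - w) = w" for w
    by (simp add: s_def map_poly_pCons of_rat_minus)
  have cPhi: "cpoly \<Phi> = (\<Prod>i = 1..k. geo (n i))"
    by (simp add: \<Phi>_def cpoly_prod cpoly_geo)
  have cR: "cpoly R = cpoly s * (\<Prod>i = 1..k. geo (n i))"
    by (simp add: R_def cPhi cpoly_mult)
  have geo_N: "geo N = cpoly \<Phi> * cpoly E"
    by (metis E cpoly_geo cpoly_mult)
  have geo_root: "poly (geo (n i)) (1 - w) = 0 \<longleftrightarrow> w \<in> Z i" if "i \<in> {1..k}" for i and w :: complex
  proof (cases "w = 1")
    case True
    then show ?thesis using npos[OF that] by (simp add: Z_def poly_0_coeff_0 coeff_0_geo)
  next
    case False
    then show ?thesis using poly_geo'[of w "n i"] by (auto simp: Z_def)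
  qed
  have root_iff: "poly (cpoly R) (1 - w) = 0 \<longleftrightarrow> w \<in> insert 0 (\<Union>j\<in>{1..k}. Z j)" for w
    using geo_root by (auto simp: cR s_eval poly_prod prod_zero_iff)
  have disjoint: "Z i \<inter> Z j = {}" if "i \<in> {1..k}" "j \<in> {1..k}" "i \<noteq> j" for i j
    using coprime_powers_eq_1[of _ "n i" "n j"] pairwiseD[OF cop that] by (auto simp: Z_def)
  have cof0: "cof j w \<noteq> 0" if "j \<in> {1..k}" "w \<in> Z j" for j w
    using that disjoint geo_root by (fastforce simp: cof_def prod_zero_iff)
  have Znz: "w \<noteq> 0" if "j \<in> {1..k}" "w \<in> Z j" for j w
    using that npos[OF that(1)] by (auto simp: Z_def power_0_left)

  have deriv_0: "poly (pderiv (cpoly R)) 1 = -1"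
  proof -
    have "poly (cpoly s) 1 = 0" using s_eval[of 0] by simp
    moreover have "(\<Prod>i = 1..k. poly (geo (n i)) 1) = (1 :: complex)"
    proof (intro prod.neutral ballI)
      fix i assume "i \<in> {1..k}"
      then show "poly (geo (n i)) 1 = (1 :: complex)"
        using poly_geo'[of "0 :: complex" "n i"] npos[of i] by (simp add: power_0_left)
    qed
    moreover have "pderiv (cpoly s) = [:-1:]"
      by (simp add: s_def map_poly_pCons of_rat_minus pderiv_pCons)
    ultimately show ?thesis by (simp add: cR pderiv_mult poly_prod)
  qed
  have deriv_w: "poly (pderiv (cpoly R)) (1 - w)
      = w * poly (pderiv (geo (n j))) (1 - w) * cof j w" if "j \<in> {1..k}" "w \<in> Z j" for j w
  proof -
    have "cpoly R = geo (n j) * (cpoly s * (\<Prod>i\<in>{1..k} - {j}. geo (n i)))"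
      using that(1) by (simp add: cR prod.remove mult_ac)
    then show ?thesis
      using that geo_root[OF that(1)] by (simp add: pderiv_mult s_eval poly_prod cof_def)
  qed
  have pderiv_geo: "w * ((1 - w) * poly (pderiv (geo (n j))) (1 - w)) = of_nat (n j)"
    if "j \<in> {1..k}" "w \<in> Z j" for j w
    using that npos by (intro poly_pderiv_geo) (auto simp: Z_def)
  have sqf: "rsquarefree (cpoly R)"
    unfolding rsquarefree_roots
  proof (intro allI notI, elim conjE)
    fix z assume z: "poly (cpoly R) z = 0" "poly (pderiv (cpoly R)) z = 0"
    have "1 - z \<in> insert 0 (\<Union>j\<in>{1..k}. Z j)" using z(1) root_iff[of "1 - z"] by simp
    then consider "z = 1" | j where "j \<in> {1..k}" "1 - z \<in> Z j" by auto
    then show False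
    proof cases
      case 1
      then show False using z(2) deriv_0 by simp
    next
      case 2
      then show False
        using z(2) deriv_w[OF 2] pderiv_geo[OF 2] cof0[OF 2] npos[OF 2(1)] by auto
    qed
  qed

  (* Compare the derivatives of both sides of geo N = \<Phi> * E at a simple root. *)
  have E_eval: "of_nat (n j) * (cof j w * poly (cpoly E) (1 - w)) = of_nat N"
    if "j \<in> {1..k}" "w \<in> Z j" for j w
  proof -
    have "n j dvd N" using that(1) by (simp add: N dvd_prodI)
    then have "w ^ N = 1" using that(2) by (auto simp: Z_def power_mult)
    then have "of_nat N = w * ((1 - w) * poly (pderiv (geo N)) (1 - w))"
      using that(2) N0 by (subst poly_pderiv_geo) (auto simp: Z_def)
    also have "poly (pderiv (geo N)) (1 - w)
        = poly (pderiv (geo (n j))) (1 - w) * (cof j w * poly (cpoly E) (1 - w))"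
    proof -
      have "geo N = geo (n j) * ((\<Prod>i\<in>{1..k} - {j}. geo (n i)) * cpoly E)"
        using that(1) by (simp add: geo_N cPhi prod.remove mult.assoc)
      then show ?thesis
        using that geo_root[OF that(1)] by (simp add: pderiv_mult poly_prod cof_def)
    qed
    also have "w * ((1 - w) * (poly (pderiv (geo (n j))) (1 - w) * (cof j w * poly (cpoly E) (1 - w))))
        = (w * ((1 - w) * poly (pderiv (geo (n j))) (1 - w))) * (cof j w * poly (cpoly E) (1 - w))"
      by (simp only: mult.assoc)
    finally show ?thesis by (simp only: pderiv_geo[OF that])
  qed
  have E_1: "poly (cpoly E) 1 = 1"
  proof -
    have g1: "poly (geo i) 1 = (1 :: complex)" if "i > 0" for i
      using poly_geo'[of "0 :: complex" i] that by (simp add: power_0_left)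
    have "poly (geo N) 1 = poly (cpoly \<Phi>) 1 * poly (cpoly E) 1"
      by (simp add: geo_N)
    moreover have "poly (cpoly \<Phi>) 1 = 1"
      using npos g1 by (simp add: cPhi poly_prod)
    ultimately show ?thesis using N0 by (simp add: g1)
  qed
  have P_eval: "poly (cpoly P) (1 - w) = poly (cpoly p) w * w ^ t * poly (cpoly E) (1 - w) ^ (r - 1)" for w
    by (simp add: P_def cpoly_mult cpoly_power cpoly_pcompose poly_pcompose s_eval poly_power)

  define f where "f w = poly (cpoly P) (1 - w) / ((1 - w) ^ M * poly (pderiv (cpoly R)) (1 - w))" for w
  (* The pole x = 0 comes from the exponent t - 1 and is removable for t > 0. *)
  have f_0: "f 0 = - of_rat (if t = 0 then poly p 0 else 0)"
    using P_eval[of 0] by (simp add: f_def deriv_0 E_1 power_0_left poly_0_coeff_0 coeff_map_poly)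
  (* The factor N ^ (r - 1) / n j ^ (r - 1) is the value at w of
     ((1 - x ^ N) / (1 - x ^ n j)) ^ (r - 1). *)
  have f_w: "f w = of_nat N ^ (r - 1) * (1 / of_nat (n j) ^ r * (poly (cpoly p) w * w ^ t
      / ((1 - w) ^ m * (\<Prod>i\<in>{1..k} - {j}. (1 - w ^ n i) ^ r))))"
    if "j \<in> {1..k}" "w \<in> Z j" for j w
  proof -
    define a where "a = (of_nat (n j) :: complex)"
    define e where "e = poly (cpoly E) (1 - w)"
    have nz: "a \<noteq> 0" "cof j w \<noteq> 0" "1 - w \<noteq> 0"
      using that npos[OF that(1)] cof0[OF that] by (auto simp: a_def Z_def)
    have "(\<Prod>i\<in>{1..k} - {j}. (1 - w ^ n i) ^ r) = (\<Prod>i\<in>{1..k} - {j}. (1 - w) ^ r * poly (geo (n i)) (1 - w) ^ r)"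
      by (simp add: poly_geo' flip: power_mult_distrib)
    also have "\<dots> = (1 - w) ^ (r * (k - 1)) * cof j w ^ r"
      using that(1) by (simp add: prod.distrib cof_def prod_power_distrib flip: power_mult)
    finally have prod_eq: "(\<Prod>i\<in>{1..k} - {j}. (1 - w ^ n i) ^ r) = (1 - w) ^ (r * (k - 1)) * cof j w ^ r" .
    have "(1 - w) ^ M * poly (pderiv (cpoly R)) (1 - w) = (1 - w) ^ (m + r * (k - 1)) *
        ((w * ((1 - w) * poly (pderiv (geo (n j))) (1 - w))) * cof j w)"
      by (simp add: M_def deriv_w[OF that] mult_ac)
    also have "\<dots> = (1 - w) ^ (m + r * (k - 1)) * (a * cof j w)"
      by (simp only: pderiv_geo[OF that] a_def)
    finally have f: "f w = poly (cpoly p) w * w ^ t * e ^ (r - 1) / ((1 - w) ^ (m + r * (k - 1)) * (a * cof j w))"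
      by (simp add: f_def P_eval e_def)
    have "of_nat N ^ (r - 1) = (a * cof j w) ^ (r - 1) * e ^ (r - 1)"
      using E_eval[OF that] by (simp add: a_def e_def mult.assoc flip: power_mult_distrib)
    moreover have "(a * cof j w) ^ r = (a * cof j w) ^ (r - 1) * (a * cof j w)"
      by (rule power_minus_mult [symmetric]) (use r in simp)
    ultimately have "f w = of_nat N ^ (r - 1) * (poly (cpoly p) w * w ^ t) / ((1 - w) ^ (m + r * (k - 1)) * (a * cof j w) ^ r)"
      using nz by (simp add: f divide_simps)
    then show ?thesis
      unfolding prod_eq by (simp add: power_add power_mult_distrib mult_ac a_def)
  qed

  have sum_f: "sum f (Z j) = of_nat N ^ (r - 1) * fd_sum m r p (int t) ({1..k} - {j}) n (n j)"
    if "j \<in> {1..k}" for j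
    unfolding fd_sum_eq[OF npos[OF that]] Z_def [symmetric] sum_distrib_left
    by (intro sum.cong) (use f_w that in auto)
  have finZ: "finite (Z j)" if "j \<in> {1..k}" for j
    using finite_roots_unity[of "n j", where 'a = complex] npos[OF that] by (auto simp: Z_def)
  have "of_nat N ^ (r - 1) * (\<Sum>j = 1..k. fd_sum m r p (int t) ({1..k} - {j}) n (n j))
      = (\<Sum>j = 1..k. sum f (Z j))"
    by (simp add: sum_distrib_left sum_f)
  also have "\<dots> = sum f (\<Union>j\<in>{1..k}. Z j)"
    by (rule sum.UNION_disjoint [symmetric]) (use finZ disjoint in auto)
  also have "\<dots> = sum f (insert 0 (\<Union>j\<in>{1..k}. Z j)) - f 0"
  proof -
    have "0 \<notin> (\<Union>j\<in>{1..k}. Z j)" using Znz by blast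
    then show ?thesis using finZ by (subst sum.insert) auto
  qed
  also have "sum f (insert 0 (\<Union>j\<in>{1..k}. Z j)) = (\<Sum>z | poly (cpoly R) z = 0.
      poly (cpoly P) z / (z ^ M * poly (pderiv (cpoly R)) z))"
  proof (rule sum.reindex_bij_witness[of _ "\<lambda>z. 1 - z" "\<lambda>w. 1 - w"])
    fix z assume "z \<in> {z. poly (cpoly R) z = 0}"
    then show "1 - z \<in> insert 0 (\<Union>j\<in>{1..k}. Z j)" using root_iff[of "1 - z"] by simp
  qed (simp_all add: root_iff f_def del: UN_iff insert_iff)
  also have "\<dots> = - of_rat ((fps_of_poly P / fps_of_poly R) $ (M - 1))"
    using sqf coeff_R deg degR by (intro sum_of_residues) (auto simp: M_def)
  also have "(fps_of_poly P / fps_of_poly R) $ (M - 1) = poly' m r p k n (- of_nat t)"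
    unfolding P_def R_def s_def M_def \<Phi>_def [symmetric]
    using poly'_eq_residue[of k r n E p t m] k r npos E by (simp add: N \<Phi>_def)
  finally show ?thesis by (simp add: f_0 of_rat_diff)
qed

theorem theorem1p1p4:
  fixes k r m d N :: nat and n :: "nat \<Rightarrow> nat" and p :: "rat poly" and t lam :: int
  assumes "k \<ge> 1"
    and "\<And>i. i \<in> {1..k} \<Longrightarrow> n i \<ge> 2"
    and "pairwise (\<lambda>i j. coprime (n i) (n j)) {1..k}"
    and "r \<ge> 1"
    and "N = (\<Prod>i = 1..k. n i)"
    and "p \<noteq> 0"
    and "d = degree p"
    and "lam = int m + int r * (\<Sum>i = 1..k. int (n i)) - (int r - 1) * int N - int d"
    and "lam > 0"
  shows
    "(t = 0 \<longrightarrow>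
       (\<Sum>j = 1..k. fd_sum m r p t ({1..k} - {j}) n (n j)) =
         of_rat (1 / of_nat N ^ (r - 1) * (poly p 0 - poly' m r p k n 0))) \<and>
     (1 \<le> t \<and> t < lam \<longrightarrow>
       (\<Sum>j = 1..k. fd_sum m r p t ({1..k} - {j}) n (n j)) =
         of_rat (- (1 / of_nat N ^ (r - 1)) * poly' m r p k n (of_int (- t))))"
proof -
  have N: "N > 0" using assms(2,5) by (fastforce intro: prod_pos)
  have main: "(\<Sum>j = 1..k. fd_sum m r p (int u) ({1..k} - {j}) n (n j))
      = of_rat (1 / of_nat N ^ (r - 1) * ((if u = 0 then poly p 0 else 0) - poly' m r p k n (- of_nat u)))"
    if "int u < lam" for u
  proof -
    have "of_nat N ^ (r - 1) * (\<Sum>j = 1..k. fd_sum m r p (int u) ({1..k} - {j}) n (n j))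
        = of_rat ((if u = 0 then poly p 0 else 0) - poly' m r p k n (- of_nat u))"
      by (rule fd_sum_eq_poly') (use assms that in auto)
    then show ?thesis
      using N by (simp add: of_rat_mult of_rat_divide of_rat_power field_simps)
  qed
  show ?thesis
  proof (intro conjI impI)
    assume "t = 0"
    then show "(\<Sum>j = 1..k. fd_sum m r p t ({1..k} - {j}) n (n j)) =
         of_rat (1 / of_nat N ^ (r - 1) * (poly p 0 - poly' m r p k n 0))"
      using main[of 0] assms(9) by simp
  next
    assume t: "1 \<le> t \<and> t < lam"
    then obtain u where u: "t = int u" "u > 0" by (metis nonneg_int_cases zero_less_imp_eq_int of_nat_0_less_iff zless_imp_add1_zle int_one_le_iff_zero_less)
    show "(\<Sum>j = 1..k. fd_sum m r p t ({1..k} - {j}) n (n j)) =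
         of_rat (- (1 / of_nat N ^ (r - 1)) * poly' m r p k n (of_int (- t)))"
      using main[of u] t u by simp
  qed
qed

end
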